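(* Let $(p_n)_{n\ge1}$ be a sequence of non-negative reals with $\sum_{n\ge1}p_n=1$ and $\gcd\{k\ge1:p_k>0\}=1$. Let $z_n=\sum_{k>n}p_k$, let $P$ be the transition operator of the associated Markov chain on $\{0,1,2,\ldots\}$, and let $u_n=\mathbb P(X_n=0\mid X_0=0)$ be its renewal probabilities. Assume that $u_n$ is non-increasing in $n$. Then for all integers $n\ge0$ and $\ell\ge1$ $$\|P^{n+\ell}\delta_0-P^n\delta_0\|_{\mathrm{TV}}=2\sum_{m=n+1}^{n+\ell}u_{n+\ell-m}\,z_m.$$
   Context: Model chain: given $p_n\ge0$ with $\sum_{n\ge1}p_n=1$, put $z_n=\sum_{k>n}p_k$ for $n\ge0$ and $q_n=p_{n+1}/z_n$ if $z_n>0$ (with $q_n\in[0,1]$ arbitrary if $z_n=0$). The associated Markov chain $X$ on $\{0,1,2,\ldots\}$ has transition probabilities $\mathbb P(X_1=0\mid X_0=n)=q_n$ and $\mathbb P(X_1=n+1\mid X_0=n)=1-q_n$. Thus $p_n$ is the probability that the first return time to $0$, starting from $0$, equals $n$. Its transition operator $P$ acts on probability measures: if $X_n\sim\mu$ then $X_{n+1}\sim P\mu$. Equivalently to the definition above, $u_0=1$ and $u_n=\sum_{k=1}^np_ku_{n-k}$ for $n\ge1$. $\delta_0$ is the unit mass at state $0$. $\|\cdot\|_{\mathrm{TV}}$ is the total variation norm, normalized so that $\|\mu-\nu\|_{\mathrm{TV}}=2\sup_A|\mu(A)-\nu(A)|$ for probability measures $\mu,\nu$. *)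

theory Defs
  imports "HOL-Probability.Probability"
begin

definition tail_prob :: "(nat \<Rightarrow> real) \<Rightarrow> nat \<Rightarrow> real" where
  "tail_prob p n = infsum p {n<..}"

text \<open>\<open>q\<close> is an admissible choice of the probabilities of a jump to \<open>0\<close>: it is determined by \<open>p\<close>
  where the tail is positive and is an arbitrary element of \<open>[0,1]\<close> elsewhere.\<close>

definition return_probs :: "(nat \<Rightarrow> real) \<Rightarrow> (nat \<Rightarrow> real) \<Rightarrow> bool" where
  "return_probs p q \<longleftrightarrow>
     (\<forall>n. 0 \<le> q n \<and> q n \<le> 1) \<and>
     (\<forall>n. tail_prob p n > 0 \<longrightarrow> q n = p (n + 1) / tail_prob p n)"

definition chain_kernel :: "(nat \<Rightarrow> real) \<Rightarrow> nat \<Rightarrow> nat pmf" where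
  "chain_kernel q n = map_pmf (\<lambda>b. if b then 0 else n + 1) (bernoulli_pmf (q n))"

lemma pmf_chain_kernel:
  assumes "0 \<le> q n" "q n \<le> 1"
  shows "pmf (chain_kernel q n) 0 = q n"
    and "pmf (chain_kernel q n) (n + 1) = 1 - q n"
proof -
  have "(\<lambda>b. if b then 0 else n + 1) -` {0} = {True}"
    and "(\<lambda>b. if b then 0 else n + 1) -` {n + 1} = {False}"
    by (auto split: if_splits)
  then show "pmf (chain_kernel q n) 0 = q n"
    and "pmf (chain_kernel q n) (n + 1) = 1 - q n"
    using assms by (simp_all add: chain_kernel_def pmf_map measure_pmf_single)
qed

text \<open>The state space is countable and discrete, so that its probability measures are given by
  the type \<^typ>\<open>nat pmf\<close>.\<close>

definition transition_op :: "(nat \<Rightarrow> real) \<Rightarrow> nat pmf \<Rightarrow> nat pmf" where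
  "transition_op q \<mu> = bind_pmf \<mu> (chain_kernel q)"

text \<open>The law of the chain at time \<open>n\<close>, when started in the state \<open>0\<close>, is the \<open>n\<close>-fold iterate of
  the transition operator at the unit mass \<^term>\<open>return_pmf (0::nat)\<close>.\<close>

definition renewal_prob :: "(nat \<Rightarrow> real) \<Rightarrow> nat \<Rightarrow> real" where
  "renewal_prob q n = measure_pmf.prob ((transition_op q ^^ n) (return_pmf 0)) {0}"

text \<open>The total variation norm \<open>\<parallel>\<mu> - \<nu>\<parallel>\<close> of the difference of two probability measures,
  normalized to have values in \<open>[0,2]\<close>.\<close>

definition tv_norm_diff :: "'a pmf \<Rightarrow> 'a pmf \<Rightarrow> real" where
  "tv_norm_diff \<mu> \<nu> = 2 * (SUP A. \<bar>measure_pmf.prob \<mu> A - measure_pmf.prob \<nu> A\<bar>)"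

end

theory Submission
  imports Defs
begin

text \<open>Reaching a state \<open>j \<le> n\<close> at time \<open>n\<close> means being at \<open>0\<close> at time \<open>n - j\<close> and moving up \<open>j\<close>
  times, which gives mass \<open>u\<^sub>n\<^sub>-\<^sub>j z\<^sub>j\<close>; no state above \<open>n\<close> is reached. As \<open>u\<close> is
  non-increasing, the law at time \<open>n + l\<close> lies below the law at time \<open>n\<close> on \<open>{0..n}\<close> and above it
  on \<open>{n<..}\<close>. The latter set is therefore optimal in the total variation distance, and its mass
  is the sum.\<close>

lemma measure_pmf_mono_pointwise:
  assumes "\<And>x. x \<in> A \<Longrightarrow> pmf \<mu> x \<le> pmf \<nu> x"
  shows "measure_pmf.prob \<mu> A \<le> measure_pmf.prob \<nu> A"
  unfolding measure_pmf_conv_infsetsum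
  by (rule infsetsum_mono) (auto intro: assms pmf_abs_summable)

text \<open>\<open>B\<close> is the positive part of a Hahn decomposition for the difference of
  \<open>\<mu>\<close> and \<open>\<nu>\<close>: dropping \<open>A - B\<close> from \<open>A\<close>
  and adding \<open>B - A\<close> can only increase the difference of masses.\<close>

lemma tv_norm_diff_eq:
  assumes ge: "\<And>x. x \<in> B \<Longrightarrow> pmf \<nu> x \<le> pmf \<mu> x"
    and le: "\<And>x. x \<notin> B \<Longrightarrow> pmf \<mu> x \<le> pmf \<nu> x"
  shows "tv_norm_diff \<mu> \<nu> = 2 * (measure_pmf.prob \<mu> B - measure_pmf.prob \<nu> B)"
proof -
  let ?d = "\<lambda>A. measure_pmf.prob \<mu> A - measure_pmf.prob \<nu> A"
  have split: "?d A = ?d (A \<inter> C) + ?d (A - C)" for A C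
    using measure_pmf.finite_measure_Union[of "A \<inter> C" \<mu> "A - C"]
      measure_pmf.finite_measure_Union[of "A \<inter> C" \<nu> "A - C"]
    by (simp add: Int_Diff_disjoint Int_Diff_Un)
  have upper: "?d A \<le> ?d B" for A
  proof -
    have "?d (A - B) \<le> 0" "0 \<le> ?d (B - A)"
      using measure_pmf_mono_pointwise[of "A - B" \<mu> \<nu>] measure_pmf_mono_pointwise[of "B - A" \<nu> \<mu>]
        le ge by auto
    with split[of A B] split[of B A] show ?thesis
      by (simp add: Int_commute)
  qed
  \<comment> \<open>Both total masses are 1, so the upper bound at \<open>- A\<close> is a lower
    bound at \<open>A\<close>.\<close>
  have compl: "?d (- A) = - ?d A" for A
    using measure_pmf.prob_compl[of A \<mu>] measure_pmf.prob_compl[of A \<nu>]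
    by (simp add: Compl_eq_Diff_UNIV)
  have bound: "\<bar>?d A\<bar> \<le> ?d B" for A
    using upper[of A] upper[of "- A"] compl[of A] by linarith
  have "(SUP A. \<bar>?d A\<bar>) = ?d B"
  proof (rule cSup_eq_maximum)
    \<comment> \<open>The bound at \<open>B\<close> itself forces \<open>?d B\<close> to be
      non-negative, so \<open>B\<close> attains the supremum.\<close>
    show "?d B \<in> range (\<lambda>A. \<bar>?d A\<bar>)"
      using bound[of B] by (intro image_eqI[of _ _ B]) auto
  qed (use bound in auto)
  then show ?thesis
    by (simp add: tv_norm_diff_def)
qed

text \<open>The only way into \<open>Suc j\<close> is the upward move from \<open>j\<close>.\<close>

lemma pmf_transition_op_Suc:
  assumes "0 \<le> q j" "q j \<le> 1"
  shows "pmf (transition_op q \<mu>) (Suc j) = pmf \<mu> j * (1 - q j)"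
proof -
  have "pmf (chain_kernel q x) (Suc j) = indicator {j} x * (1 - q j)" for x
  proof (cases "x = j")
    case True
    then show ?thesis
      using pmf_chain_kernel(2)[of q j] assms by simp
  next
    case False
    then have "Suc j \<notin> set_pmf (chain_kernel q x)"
      by (auto simp: chain_kernel_def)
    with False show ?thesis
      by (simp add: pmf_eq_0_set_pmf)
  qed
  then show ?thesis
    by (simp add: transition_op_def pmf_bind measure_pmf_single)
qed

lemma tail_prob_Suc:
  assumes "p summable_on {n<..}"
  shows "tail_prob p n = p (Suc n) + tail_prob p (Suc n)"
proof -
  have eq: "{n<..} = insert (Suc n) {Suc n<..}"
    by auto
  have "p summable_on {Suc n<..}"
    using assms by (rule summable_on_subset_banach) auto
  then show ?thesis
    by (simp add: tail_prob_def eq infsum_insert)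
qed

lemma tail_prob_nonneg:
  assumes "\<And>k. n < k \<Longrightarrow> 0 \<le> p k"
  shows "0 \<le> tail_prob p n"
  unfolding tail_prob_def by (rule infsum_nonneg) (use assms in auto)

text \<open>A division-free form of the formula for \<open>q n\<close>, valid also where the tail
  vanishes and \<open>q n\<close> is arbitrary: the next tail then vanishes too.\<close>

lemma tail_prob_step:
  assumes nonneg: "\<And>k. k \<ge> 1 \<Longrightarrow> p k \<ge> 0" and summable: "p summable_on {1..}"
    and rp: "return_probs p q"
  shows "tail_prob p n * (1 - q n) = tail_prob p (Suc n)"
proof -
  have rec: "tail_prob p n = p (Suc n) + tail_prob p (Suc n)"
    by (rule tail_prob_Suc, rule summable_on_subset_banach[OF summable]) auto
  have nn: "0 \<le> p (Suc n)" "0 \<le> tail_prob p (Suc n)" "0 \<le> tail_prob p n"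
    using nonneg by (auto intro!: tail_prob_nonneg)
  show ?thesis
  proof (cases "tail_prob p n = 0")
    case True
    with rec nn show ?thesis by simp
  next
    case False
    with nn have "tail_prob p n * q n = p (Suc n)"
      using rp by (simp add: return_probs_def)
    with rec show ?thesis by (simp add: right_diff_distrib)
  qed
qed

text \<open>Induction on \<open>j\<close> for all \<open>n\<close> at once: each upward move lowers
  state and time together, keeping \<open>n - j\<close> fixed, and its factor \<open>1 - q j\<close>
  turns \<open>tail_prob p j\<close> into the next tail.\<close>

lemma pmf_chain_law:
  assumes nonneg: "\<And>k. k \<ge> 1 \<Longrightarrow> p k \<ge> 0" and sum: "(p has_sum 1) {1..}"
    and rp: "return_probs p q"
  shows "pmf ((transition_op q ^^ n) (return_pmf 0)) j
    = (if j \<le> n then renewal_prob q (n - j) * tail_prob p j else 0)"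
proof -
  have "{0<..} = {1::nat..}"
    by auto
  then have z0: "tail_prob p 0 = 1"
    using infsumI[OF sum] by (simp add: tail_prob_def)
  show ?thesis
  proof (induction j arbitrary: n)
    case 0
    then show ?case
      by (simp add: z0 renewal_prob_def measure_pmf_single)
  next
    case (Suc j)
    show ?case
    proof (cases n)
      case 0
      then show ?thesis by simp
    next
      case (Suc m)
      have "pmf ((transition_op q ^^ n) (return_pmf 0)) (Suc j)
          = pmf ((transition_op q ^^ m) (return_pmf 0)) j * (1 - q j)"
        using rp by (simp add: Suc pmf_transition_op_Suc return_probs_def)
      also have "\<dots> = (if j \<le> m then renewal_prob q (m - j) * (tail_prob p j * (1 - q j)) else 0)"
        by (simp add: Suc.IH)
      finally show ?thesis
        using tail_prob_step[OF nonneg has_sum_imp_summable[OF sum] rp, of j] by (simp add: Suc)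
    qed
  qed
qed

theorem theorem2p8:
  fixes p q :: "nat \<Rightarrow> real" and n l :: nat
  assumes "\<And>k. k \<ge> 1 \<Longrightarrow> p k \<ge> 0"
    and "(p has_sum 1) {1..}"
    and "Gcd {k. k \<ge> 1 \<and> p k > 0} = 1"
    and "return_probs p q"
    and "decseq (renewal_prob q)"
    and "l \<ge> 1"
  shows "tv_norm_diff ((transition_op q ^^ (n + l)) (return_pmf 0))
                      ((transition_op q ^^ n) (return_pmf 0))
         = 2 * (\<Sum>m = n + 1..n + l. renewal_prob q (n + l - m) * tail_prob p m)"
proof -
  define law where "law k = (transition_op q ^^ k) (return_pmf 0)" for k
  have law: "pmf (law k) j = (if j \<le> k then renewal_prob q (k - j) * tail_prob p j else 0)" for k j
    using pmf_chain_law[OF assms(1,2,4)] by (simp add: law_def)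
  have supp: "set_pmf (law k) \<subseteq> {..k}" for k
    by (auto simp: set_pmf_iff law split: if_splits)
  have "tv_norm_diff (law (n + l)) (law n)
      = 2 * (measure_pmf.prob (law (n + l)) {n<..} - measure_pmf.prob (law n) {n<..})"
  proof (rule tv_norm_diff_eq)
    \<comment> \<open>Here \<open>j \<le> n\<close>, so both laws have the product form with the
      same factor \<open>tail_prob p j\<close>, and only the renewal probabilities are
      compared.\<close>
    fix j assume "j \<notin> {n<..}"
    moreover have "renewal_prob q (n + l - j) \<le> renewal_prob q (n - j)"
      by (rule decseqD[OF assms(5)]) auto
    moreover have "0 \<le> tail_prob p j"
      using assms(1) by (intro tail_prob_nonneg) auto
    ultimately show "pmf (law (n + l)) j \<le> pmf (law n) j"
      by (simp add: law mult_right_mono)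
  next
    fix j assume "j \<in> {n<..}"
    then have "pmf (law n) j = 0"
      by (simp add: law)
    then show "pmf (law n) j \<le> pmf (law (n + l)) j"
      by simp
  qed
  also have "measure_pmf.prob (law n) {n<..} = 0"
    using supp[of n] by (auto simp: measure_pmf_zero_iff)
  \<comment> \<open>No mass lies above \<open>n + l\<close>, which leaves a finite set and hence a
    finite sum.\<close>
  also have "measure_pmf.prob (law (n + l)) {n<..} = measure_pmf.prob (law (n + l)) {n + 1..n + l}"
    by (rule measure_prob_cong_0) (auto simp: law)
  also have "\<dots> = (\<Sum>m = n + 1..n + l. renewal_prob q (n + l - m) * tail_prob p m)"
    by (simp add: measure_measure_pmf_finite law)
  finally show ?thesis
    by (simp add: law_def)
qed

end
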